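(* Let $q_0,q_1,q_2,\ldots$ be the positions of the queens placed greedily along the square spiral on $\mathbb Z\times\mathbb Z$, and let $X_n,Y_n,M_n,P_n$ $(n\ge 0)$ be the recursively defined sequences given in the context. Then $q_0=(X_0,Y_0)=(0,0)$, and for all $k=0,1,2,\ldots$ $$q_{4k+1}=(X_{k+1},Y_{k+1}),\quad q_{4k+2}=(-Y_{k+1},X_{k+1}),\quad q_{4k+3}=(-X_{k+1},-Y_{k+1}),\quad q_{4k+4}=(Y_{k+1},-X_{k+1}).$$
   Context: Square spiral: the cells of the board are the points $(x,y)\in\mathbb Z\times\mathbb Z$, where the $x$-axis points South and the $y$-axis points East. The cells are numbered $0,1,2,\ldots$ along a square spiral starting at $(0,0)$ and moving successively East, North, West, South, East, North, .... Explicitly, cell $0$ is $(0,0)$, and for $k\ge1$ shell $k$ (the $8k$ cells with $\max(|x|,|y|)=k$) contains the cells numbered $(2k-1)^2,\ldots,4k(k+1)$, traversed in this order: $(k-1,k),(k-2,k),\ldots,(-k,k)$ (edge 1), then $(-k,k-1),\ldots,(-k,-k)$ (edge 2), then $(-k+1,-k),\ldots,(k,-k)$ (edge 3), then $(k,-k+1),\ldots,(k,k)$ (edge 4). Shells are traversed in the order $0,1,2,\ldots$. Greedy placement: the cells are considered in the order of their numbers, and a queen is placed in a cell if and only if it would not attack any queen placed earlier. Two queens attack each other if they share a row, a column, or a diagonal of slope $\pm1$ (blocking by other queens is irrelevant). $q_n$ ($n\ge0$) denotes the $(x,y)$ coordinates of the $n$th queen placed, starting with $q_0$ in cell $0$.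 Sequences: $\operatorname{mex}(S)$ is the smallest nonnegative integer not in $S$. Set $X_0=Y_0=M_0=P_0=0$ and, for $n>0$, $X_n=\operatorname{mex}\{X_i,Y_i:i<n\}$, $M_n=\operatorname{mex}\{M_i,P_i:i<n\}$, $Y_n=X_n+M_n$, $P_n=X_n+Y_n$. *)

theory Defs
  imports Complex_Main "HOL-Library.Infinite_Set"
begin

text \<open>The \<open>x\<close>-axis points South and the \<open>y\<close>-axis points East, so moving North decreases the
  first coordinate.\<close>

type_synonym cell = "int \<times> int"

definition shell :: "nat \<Rightarrow> nat" where
  "shell n = (LEAST k. n < (2 * k + 1)\<^sup>2)"

text \<open>In shell \<open>k \<ge> 1\<close> the cell numbered \<open>n\<close> has offset \<open>j = n - (2k-1)\<^sup>2\<close>, with \<open>0 \<le> j < 8k\<close>;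
  each of the four edges consists of \<open>2k\<close> cells.\<close>

definition spiral :: "nat \<Rightarrow> cell" where
  "spiral n =
    (if n = 0 then (0, 0) else
     let k = int (shell n); j = int n - (2 * k - 1)\<^sup>2 in
       if j < 2 * k then (k - 1 - j, k)
       else if j < 4 * k then (- k, k - 1 - (j - 2 * k))
       else if j < 6 * k then (- k + 1 + (j - 4 * k), - k)
       else (k, - k + 1 + (j - 6 * k)))"

definition attacks :: "cell \<Rightarrow> cell \<Rightarrow> bool" where
  "attacks p q \<longleftrightarrow>
     fst p = fst q \<or> snd p = snd q \<or>
     fst p - snd p = fst q - snd q \<or> fst p + snd p = fst q + snd q"

fun has_queen :: "nat \<Rightarrow> bool" where
  "has_queen n \<longleftrightarrow> (\<forall>m<n. has_queen m \<longrightarrow> \<not> attacks (spiral m) (spiral n))"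

declare has_queen.simps [simp del]

text \<open>\<^const>\<open>enumerate\<close> lists a set of naturals increasingly, starting with index \<open>0\<close>. It is
  meaningful at every index only for an infinite set; see \<open>infinite_has_queen\<close> below.\<close>

definition queen :: "nat \<Rightarrow> cell" where
  "queen n = spiral (enumerate {m. has_queen m} n)"

definition mex :: "nat set \<Rightarrow> nat" where
  "mex S = (LEAST n. n \<notin> S)"

function X_seq Y_seq M_seq P_seq :: "nat \<Rightarrow> nat" where
  "X_seq n = (if n = 0 then 0 else mex (X_seq ` {..<n} \<union> Y_seq ` {..<n}))"
| "Y_seq n = (if n = 0 then 0 else X_seq n + M_seq n)"
| "M_seq n = (if n = 0 then 0 else mex (M_seq ` {..<n} \<union> P_seq ` {..<n}))"
| "P_seq n = (if n = 0 then 0 else X_seq n + Y_seq n)"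
  by pat_completeness auto
termination
  by (relation "measure (case_sum (case_sum (\<lambda>n. 3 * n) (\<lambda>n. 3 * n + 1))
                                  (case_sum (\<lambda>n. 3 * n) (\<lambda>n. 3 * n + 2)))") auto

declare X_seq.simps [simp del] Y_seq.simps [simp del] M_seq.simps [simp del] P_seq.simps [simp del]

lemma shell_eq:
  assumes "k \<ge> 1" "j < 8 * k"
  shows "shell ((2 * k - 1)\<^sup>2 + j) = k"
  unfolding shell_def
proof (rule Least_equality)
  obtain i where k: "k = Suc i" using assms(1) by (cases k) auto
  show "(2 * k - 1)\<^sup>2 + j < (2 * k + 1)\<^sup>2"
    using assms(2) unfolding k by (simp add: power2_eq_square algebra_simps)
  fix l assume l: "(2 * k - 1)\<^sup>2 + j < (2 * l + 1)\<^sup>2"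
  show "k \<le> l"
  proof (rule ccontr)
    assume "\<not> k \<le> l"
    then have "2 * l + 1 \<le> 2 * k - 1" by simp
    then have "(2 * l + 1)\<^sup>2 \<le> (2 * k - 1)\<^sup>2" by (rule power_mono) simp
    with l show False by linarith
  qed
qed

lemma spiral_shell:
  assumes "k \<ge> 1" "j < 8 * k"
  shows "spiral ((2 * k - 1)\<^sup>2 + j) =
    (if j < 2 * k then (int k - 1 - int j, int k)
     else if j < 4 * k then (- int k, int k - 1 - (int j - 2 * int k))
     else if j < 6 * k then (- int k + 1 + (int j - 4 * int k), - int k)
     else (int k, - int k + 1 + (int j - 6 * int k)))"
proof -
  have "int ((2 * k - 1)\<^sup>2 + j) - (2 * int k - 1)\<^sup>2 = int j"
    using assms(1) by (simp add: of_nat_diff)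
  moreover have "(2 * k - 1)\<^sup>2 + j \<noteq> 0" using assms(1) by simp
  ultimately show ?thesis
    unfolding spiral_def shell_eq[OF assms] Let_def by auto
qed

lemma surj_spiral: "surj spiral"
proof -
  have "\<exists>n. spiral n = (x, y)" for x y :: int
  proof (cases "x = 0 \<and> y = 0")
    case True
    then show ?thesis by (intro exI[of _ 0]) (simp add: spiral_def)
  next
    case False
    define k where "k = nat (max \<bar>x\<bar> \<bar>y\<bar>)"
    have k: "int k = max \<bar>x\<bar> \<bar>y\<bar>" "k \<ge> 1" using False by (auto simp: k_def)
    define j where "j = nat (if y = int k \<and> x < int k then int k - 1 - x
      else if x = - int k then 3 * int k - 1 - y
      else if y = - int k then x + 5 * int k - 1
      else y + 7 * int k - 1)"
    have xy: "\<bar>x\<bar> \<le> int k" "\<bar>y\<bar> \<le> int k"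
        "x = int k \<or> x = - int k \<or> y = int k \<or> y = - int k"
      using k by (auto simp: max_def abs_if split: if_splits)
    have "j < 8 * k" using xy k(2) by (auto simp: j_def split: if_splits)
    moreover have "spiral ((2 * k - 1)\<^sup>2 + j) = (x, y)"
      unfolding spiral_shell[OF k(2) \<open>j < 8 * k\<close>] using xy k(2)
      by (auto simp: j_def split: if_splits)
    ultimately show ?thesis by blast
  qed
  then show ?thesis unfolding surj_def by (metis prod.collapse)
qed

lemma infinite_has_queen: "infinite {n. has_queen n}"
proof
  assume fin: "finite {n. has_queen n}"
  define B where "B = Max (insert 0 ((\<lambda>n. max \<bar>fst (spiral n)\<bar> \<bar>snd (spiral n)\<bar>) ` {n. has_queen n}))"
  have bound: "\<bar>fst (spiral m)\<bar> \<le> B \<and> \<bar>snd (spiral m)\<bar> \<le> B" if "has_queen m" for m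
  proof -
    have "max \<bar>fst (spiral m)\<bar> \<bar>snd (spiral m)\<bar> \<le> B"
      unfolding B_def by (rule Max_ge) (use fin that in auto)
    then show ?thesis by simp
  qed
  obtain n where n: "spiral n = (B + 1, 3 * B + 2)" using surj_spiral by (metis surjD)
  have "B \<ge> 0" unfolding B_def by (rule Max_ge) (use fin in auto)
  have "\<not> attacks (spiral m) (spiral n)" if "has_queen m" for m
    using bound[OF that] \<open>B \<ge> 0\<close> by (auto simp: attacks_def n)
  then have "has_queen n" by (subst has_queen.simps) blast
  from bound[OF this] \<open>B \<ge> 0\<close> show False by (simp add: n)
qed

end

theory Submission
  imports Defs
begin

text \<open>
  The spiral, the attack relation and the claimed set of queens are all invariant under the
  quarter turn \<open>(x, y) \<mapsto> (- y, x)\<close>, which maps each edge of a shell to the next one. The four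
  rotations of \<open>(X\<^sub>i, Y\<^sub>i)\<close> together attack exactly the cells \<open>(x, y)\<close> for which \<open>\<bar>x\<bar>\<close> or \<open>\<bar>y\<bar>\<close>
  lies in \<open>{X\<^sub>i, Y\<^sub>i}\<close> or \<open>\<bar>x - y\<bar>\<close> or \<open>\<bar>x + y\<bar>\<close> lies in \<open>{M\<^sub>i, P\<^sub>i}\<close> (lemma \<open>orbit_attacks_iff\<close>).
  For different indices \<open>i\<close> the sets \<open>{X\<^sub>i, Y\<^sub>i}\<close> are disjoint, and so are the sets
  \<open>{M\<^sub>i, P\<^sub>i}\<close>; hence rotations of different \<open>(X\<^sub>i, Y\<^sub>i)\<close> do not attack each other. For a single
  \<open>i > 0\<close> the four rotations are mutually non-attacking because \<open>X\<^sub>i\<close> and \<open>M\<^sub>i = Y\<^sub>i - X\<^sub>i\<close> are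
  positive.

  Conversely, let \<open>(x, k)\<close> be a cell on the first edge of shell \<open>k\<close>, let \<open>n\<close> be least with
  \<open>k \<le> Y\<^sub>n\<close>, and suppose that no rotation of \<open>(X\<^sub>i, Y\<^sub>i)\<close> with \<open>i < n\<close> attacks it. By the definition
  of \<open>X\<^sub>n\<close> and \<open>M\<^sub>n\<close> as minimal excludants, \<open>\<bar>x\<bar> \<ge> X\<^sub>n\<close> and \<open>k - \<bar>x\<bar> \<ge> M\<^sub>n\<close>. Hence
  \<open>k \<ge> X\<^sub>n + M\<^sub>n = Y\<^sub>n\<close>, so that \<open>k = Y\<^sub>n\<close> and \<open>\<bar>x\<bar> = X\<^sub>n\<close>. The spiral meets \<open>(X\<^sub>n, Y\<^sub>n)\<close>
  before \<open>(- X\<^sub>n, Y\<^sub>n)\<close>, and the former, which is a claimed queen, attacks the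
  latter. Thus every cell outside the claimed set is attacked by an earlier claimed queen (lemma \<open>dominated\<close>), which
  characterises the greedy placement (lemma \<open>has_queen_iffI\<close>).
\<close>

section \<open>The four sequences\<close>

lemma mex_notin: "finite S \<Longrightarrow> mex S \<notin> S"
  unfolding mex_def by (metis LeastI_ex ex_new_if_finite infinite_UNIV_nat)

lemma mex_le: "m \<notin> S \<Longrightarrow> mex S \<le> m"
  unfolding mex_def by (rule Least_le)

lemma mex_mono: "finite T \<Longrightarrow> S \<subseteq> T \<Longrightarrow> mex S \<le> mex T"
  using mex_le mex_notin by blast

lemma seq_0 [simp]: "X_seq 0 = 0" "Y_seq 0 = 0" "M_seq 0 = 0" "P_seq 0 = 0"
  by (simp_all add: X_seq.simps Y_seq.simps M_seq.simps P_seq.simps)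

lemma mex_0: "mex {} = 0"
  using mex_le[of 0 "{}"] by simp

lemma X_mex: "X_seq n = mex (X_seq ` {..<n} \<union> Y_seq ` {..<n})"
  by (cases "n = 0") (simp add: mex_0, simp add: X_seq.simps[of n])

lemma M_mex: "M_seq n = mex (M_seq ` {..<n} \<union> P_seq ` {..<n})"
  by (cases "n = 0") (simp add: mex_0, simp add: M_seq.simps[of n])

lemma Y_eq: "Y_seq n = X_seq n + M_seq n"
  by (cases "n = 0") (simp, simp add: Y_seq.simps[of n])

lemma P_eq: "P_seq n = X_seq n + Y_seq n"
  by (cases "n = 0") (simp, simp add: P_seq.simps[of n])

lemma X_notin: "X_seq n \<notin> X_seq ` {..<n} \<union> Y_seq ` {..<n}"
  by (subst X_mex, rule mex_notin) simp

lemma M_notin: "M_seq n \<notin> M_seq ` {..<n} \<union> P_seq ` {..<n}"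
  by (subst M_mex, rule mex_notin) simp

lemma X_le: "m \<notin> X_seq ` {..<n} \<union> Y_seq ` {..<n} \<Longrightarrow> X_seq n \<le> m"
  by (subst X_mex) (rule mex_le)

lemma M_le: "m \<notin> M_seq ` {..<n} \<union> P_seq ` {..<n} \<Longrightarrow> M_seq n \<le> m"
  by (subst M_mex) (rule mex_le)

lemma X_less: "i < n \<Longrightarrow> X_seq i < X_seq n"
proof -
  assume "i < n"
  then have "X_seq i \<le> X_seq n" by (subst (1 2) X_mex, intro mex_mono) auto
  moreover have "X_seq i \<noteq> X_seq n" using X_notin[of n] \<open>i < n\<close> by (metis UnI1 image_eqI lessThan_iff)
  ultimately show ?thesis by simp
qed

lemma M_less: "i < n \<Longrightarrow> M_seq i < M_seq n"
proof -
  assume "i < n"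
  then have "M_seq i \<le> M_seq n" by (subst (1 2) M_mex, intro mex_mono) auto
  moreover have "M_seq i \<noteq> M_seq n" using M_notin[of n] \<open>i < n\<close> by (metis UnI1 image_eqI lessThan_iff)
  ultimately show ?thesis by simp
qed

lemma Y_less: "i < n \<Longrightarrow> Y_seq i < Y_seq n"
  using X_less[of i n] M_less[of i n] by (simp add: Y_eq)

lemma X_pos: "0 < n \<Longrightarrow> 0 < X_seq n"
  using X_less[of 0 n] by simp

lemma M_pos: "0 < n \<Longrightarrow> 0 < M_seq n"
  using M_less[of 0 n] by simp

lemma XY_disjoint:
  assumes "i < n"
  shows "X_seq n \<noteq> X_seq i" "X_seq n \<noteq> Y_seq i" "Y_seq n \<noteq> X_seq i" "Y_seq n \<noteq> Y_seq i"
proof -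
  show "X_seq n \<noteq> Y_seq i" using X_notin[of n] assms by (metis UnI2 image_eqI lessThan_iff)
qed (use X_less[OF assms] Y_less[OF assms] Y_eq[of n] in linarith)+

lemma MP_disjoint:
  assumes "i < n"
  shows "M_seq n \<noteq> M_seq i" "M_seq n \<noteq> P_seq i" "P_seq n \<noteq> M_seq i" "P_seq n \<noteq> P_seq i"
proof -
  show "M_seq n \<noteq> P_seq i" using M_notin[of n] assms by (metis UnI2 image_eqI lessThan_iff)
qed (use M_less[OF assms] X_less[OF assms] Y_eq[of n] P_eq[of n] Y_eq[of i] P_eq[of i] in linarith)+

section \<open>Quarter turns\<close>

text \<open>The quarter turn that maps each edge of a shell onto the next one.\<close>

definition rot :: "cell \<Rightarrow> cell" where
  "rot p = (- snd p, fst p)"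

lemma less_4_cases: "r < 4 \<Longrightarrow> r = 0 \<or> r = 1 \<or> r = 2 \<or> r = (3::nat)"
  by auto

lemma rot_pow_2_3 [simp]:
  "(rot ^^ 2) p = (- fst p, - snd p)" "(rot ^^ 3) p = (snd p, - fst p)"
  by (simp_all add: rot_def numeral_eq_Suc)

lemma attacks_rot: "attacks (rot p) (rot q) \<longleftrightarrow> attacks p q"
  by (auto simp: attacks_def rot_def)

lemma attacks_rot_pow: "attacks ((rot ^^ s) p) ((rot ^^ s) q) \<longleftrightarrow> attacks p q"
  by (induction s) (simp_all add: attacks_rot)

lemma rot_pow_4: "(rot ^^ 4) p = p"
  by (simp add: rot_def numeral_eq_Suc)

lemma rot_pow_mod: "(rot ^^ (r mod 4)) p = (rot ^^ r) p"
proof -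
  have fix4: "(rot ^^ (4 * k)) p = p" for k
    by (induction k) (simp_all add: funpow_add rot_pow_4)
  have "(rot ^^ (r mod 4 + 4 * (r div 4))) p = (rot ^^ (r mod 4)) p"
    by (simp only: funpow_add comp_apply fix4)
  then show ?thesis by simp
qed

text \<open>The rotations of \<open>(X\<^sub>i, Y\<^sub>i)\<close> occupy the rows and columns \<open>\<plusminus> X\<^sub>i, \<plusminus> Y\<^sub>i\<close> and, in either
  direction, the diagonals \<open>\<plusminus> M\<^sub>i, \<plusminus> P\<^sub>i\<close>.\<close>

lemma orbit_attacks_iff:
  "(\<exists>r<4. attacks ((rot ^^ r) (int (X_seq i), int (Y_seq i))) (x, y)) \<longleftrightarrow>
     \<bar>x\<bar> \<in> {int (X_seq i), int (Y_seq i)} \<or> \<bar>y\<bar> \<in> {int (X_seq i), int (Y_seq i)} \<or>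
     \<bar>x - y\<bar> \<in> {int (M_seq i), int (P_seq i)} \<or> \<bar>x + y\<bar> \<in> {int (M_seq i), int (P_seq i)}"
proof -
  have ex: "(\<exists>r<4. Q r) \<longleftrightarrow> Q 0 \<or> Q 1 \<or> Q 2 \<or> Q (3::nat)" for Q
    by (simp add: numeral_eq_Suc Ex_less_Suc disj_ac)
  have abs: "\<bar>z\<bar> \<in> {int u, int v} \<longleftrightarrow> int u = z \<or> - int u = z \<or> int v = z \<or> - int v = z"
    for u v :: nat and z :: int by auto
  let ?a = "int (X_seq i)" and ?b = "int (Y_seq i)" and ?d = "int (M_seq i)" and ?s = "int (P_seq i)"
  have diag: "?a - ?b = - ?d" "- ?b - ?a = - ?s" "- ?a - - ?b = ?d" "?b - - ?a = ?s"
    "?a + ?b = ?s" "- ?b + ?a = - ?d" "- ?a + - ?b = - ?s" "?b + - ?a = ?d"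
    by (simp_all add: Y_eq P_eq)
  have turns: "(rot ^^ 0) (?a, ?b) = (?a, ?b)" "(rot ^^ 1) (?a, ?b) = (- ?b, ?a)"
    "(rot ^^ 2) (?a, ?b) = (- ?a, - ?b)" "(rot ^^ 3) (?a, ?b) = (?b, - ?a)"
    by (simp_all add: rot_def)
  show ?thesis
    unfolding ex turns attacks_def fst_conv snd_conv diag abs by (simp only: disj_ac)
qed

section \<open>Spiral indices\<close>

lemma spiral_rot:
  assumes "r < 4" "j < 2 * k"
  shows "spiral ((2 * k - 1)\<^sup>2 + 2 * k * r + j) = (rot ^^ r) (int k - 1 - int j, int k)"
proof -
  have *: "1 \<le> k" "2 * k * r + j < 8 * k" using assms less_4_cases[OF assms(1)] by auto
  show ?thesis
    using less_4_cases[OF assms(1)] assms(2) spiral_shell[OF *]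
    by (elim disjE) (simp_all add: rot_def add.assoc)
qed

text \<open>The decomposition of a positive index into shell, edge and offset on the edge.\<close>

lemma spiral_index_cases:
  fixes m :: nat
  assumes "m \<noteq> 0"
  obtains k r j where "m = (2 * k - 1)\<^sup>2 + 2 * k * r + j" "r < 4" "j < 2 * k"
proof -
  define k where "k = shell m"
  have ex: "m < (2 * m + 1)\<^sup>2" by (simp add: power2_eq_square)
  have up: "m < (2 * k + 1)\<^sup>2"
    unfolding k_def shell_def by (rule LeastI[of "\<lambda>k. m < (2 * k + 1)\<^sup>2", OF ex])
  with assms have "k \<noteq> 0" by (intro notI) simp
  then obtain l where l: "k = Suc l" by (cases k) auto
  have "\<not> m < (2 * l + 1)\<^sup>2"
    using not_less_Least[of l "\<lambda>k. m < (2 * k + 1)\<^sup>2"] l by (simp add: k_def shell_def)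
  then have low: "(2 * k - 1)\<^sup>2 \<le> m" by (simp add: l)
  define t where "t = m - (2 * k - 1)\<^sup>2"
  have m: "m = (2 * k - 1)\<^sup>2 + t" using low by (simp add: t_def)
  have "t < 4 * (2 * k)" using up m l by (simp add: power2_eq_square algebra_simps)
  then have "t div (2 * k) < 4" by (simp add: less_mult_imp_div_less)
  moreover have "t mod (2 * k) < 2 * k" using l by simp
  moreover have "m = (2 * k - 1)\<^sup>2 + 2 * k * (t div (2 * k)) + t mod (2 * k)"
    unfolding m add.assoc mult_div_mod_eq ..
  ultimately show thesis using that by blast
qed

text \<open>The spiral index of the \<open>r\<close>-th rotation of \<open>(X\<^sub>n, Y\<^sub>n)\<close>. For \<open>n = 0\<close> all rotations
  coincide with cell \<open>0\<close>. For \<open>n > 0\<close> the cell lies in shell \<open>Y\<^sub>n\<close>, on edge \<open>r\<close> counted from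
  \<open>0\<close>, at offset \<open>Y\<^sub>n - 1 - X\<^sub>n = M\<^sub>n - 1\<close>.\<close>

definition idx :: "nat \<Rightarrow> nat \<Rightarrow> nat" where
  "idx n r = (if n = 0 then 0
     else (2 * Y_seq n - 1)\<^sup>2 + 2 * Y_seq n * r + (M_seq n - 1))"

lemma spiral_idx:
  assumes "r < 4"
  shows "spiral (idx n r) = (rot ^^ r) (int (X_seq n), int (Y_seq n))"
proof (cases "n = 0")
  case True
  then show ?thesis using less_4_cases[OF assms]
    by (auto simp: idx_def spiral_def rot_def)
next
  case False
  then have "M_seq n \<ge> 1" using M_pos[of n] by simp
  then have "M_seq n - 1 < 2 * Y_seq n" "int (Y_seq n) - 1 - int (M_seq n - 1) = int (X_seq n)"
    by (simp_all add: Y_eq of_nat_diff)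
  with spiral_rot[OF assms, of "M_seq n - 1" "Y_seq n"] False show ?thesis
    by (simp add: idx_def)
qed

lemma idx_less_shell:
  assumes "r < 4" "Y_seq n < k"
  shows "idx n r < (2 * k - 1)\<^sup>2"
proof (cases "n = 0")
  case True
  then show ?thesis using assms by (simp add: idx_def)
next
  case False
  have *: "1 \<le> M_seq n" "M_seq n \<le> Y_seq n" using M_pos[of n] False by (simp_all add: Y_eq)
  then obtain l where l: "Y_seq n = Suc l" by (cases "Y_seq n") auto
  have "2 * Y_seq n * r \<le> 2 * Y_seq n * 3" using assms(1) by (intro mult_left_mono) auto
  then have "2 * Y_seq n * r + (M_seq n - 1) < 8 * Y_seq n" using * by linarith
  then have "idx n r < (2 * Y_seq n - 1)\<^sup>2 + 8 * Y_seq n" using False by (simp add: idx_def)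
  also have "\<dots> = (2 * Y_seq n + 1)\<^sup>2" by (simp add: l power2_eq_square algebra_simps)
  also have "\<dots> \<le> (2 * k - 1)\<^sup>2" using assms(2) by (intro power_mono) auto
  finally show ?thesis .
qed

lemma idx_less:
  assumes "i < n" "r < 4"
  shows "idx i r < idx n s"
proof -
  have "idx i r < (2 * Y_seq n - 1)\<^sup>2" by (intro idx_less_shell assms Y_less)
  also have "\<dots> \<le> idx n s" using assms by (simp add: idx_def)
  finally show ?thesis .
qed

section \<open>The greedy placement\<close>

text \<open>An independent set of cells is the greedy one if every other cell is attacked by an
  earlier cell of the set.\<close>

lemma has_queen_iffI:
  assumes indep: "\<And>m n. m \<in> S \<Longrightarrow> n \<in> S \<Longrightarrow> m < n \<Longrightarrow> \<not> attacks (spiral m) (spiral n)"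
    and dom: "\<And>n. n \<notin> S \<Longrightarrow> \<exists>m\<in>S. m < n \<and> attacks (spiral m) (spiral n)"
  shows "has_queen n \<longleftrightarrow> n \<in> S"
proof (induction n rule: less_induct)
  case (less n)
  have "has_queen n \<longleftrightarrow> (\<forall>m<n. m \<in> S \<longrightarrow> \<not> attacks (spiral m) (spiral n))"
    by (subst has_queen.simps) (use less in blast)
  also have "\<dots> \<longleftrightarrow> n \<in> S" using indep dom by blast
  finally show ?case .
qed

lemma not_attacks_orbit:
  assumes "r < 4" "s < 4" "0 < n" "r \<noteq> s"
  shows "\<not> attacks ((rot ^^ r) (int (X_seq n), int (Y_seq n)))
                   ((rot ^^ s) (int (X_seq n), int (Y_seq n)))"
  using less_4_cases[OF assms(1)] less_4_cases[OF assms(2)] assms(4)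
    X_pos[OF assms(3)] M_pos[OF assms(3)]
  by (auto simp: attacks_def rot_def Y_eq)

lemma not_attacks_earlier:
  assumes "r < 4" "s < 4" "i < n"
  shows "\<not> attacks ((rot ^^ r) (int (X_seq i), int (Y_seq i)))
                   ((rot ^^ s) (int (X_seq n), int (Y_seq n)))"
proof -
  obtain x y where xy: "(rot ^^ s) (int (X_seq n), int (Y_seq n)) = (x, y)" by fastforce
  have "\<bar>x\<bar> \<in> {int (X_seq n), int (Y_seq n)}" "\<bar>y\<bar> \<in> {int (X_seq n), int (Y_seq n)}"
    "\<bar>x - y\<bar> \<in> {int (M_seq n), int (P_seq n)}" "\<bar>x + y\<bar> \<in> {int (M_seq n), int (P_seq n)}"
    using xy less_4_cases[OF assms(2)] by (auto simp: rot_def Y_eq P_eq)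
  moreover have "{int (X_seq n), int (Y_seq n)} \<inter> {int (X_seq i), int (Y_seq i)} = {}"
    "{int (M_seq n), int (P_seq n)} \<inter> {int (M_seq i), int (P_seq i)} = {}"
    using XY_disjoint[OF assms(3)] MP_disjoint[OF assms(3)] by simp_all
  ultimately have "\<not> (\<exists>r<4. attacks ((rot ^^ r) (int (X_seq i), int (Y_seq i))) (x, y))"
    unfolding orbit_attacks_iff by blast
  then show ?thesis unfolding xy using assms(1) by blast
qed

text \<open>Up to shell \<open>Y\<^sub>n\<close>, the orbits of index less than \<open>n\<close> leave no cell \<open>(x, k)\<close> with \<open>\<bar>x\<bar> \<le> k\<close>
  unattacked except possibly \<open>(\<plusminus> X\<^sub>n, Y\<^sub>n)\<close>. This is where the minimality of the excludants enters.\<close>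

lemma free_cell:
  assumes "\<bar>x\<bar> \<le> int k" "k \<le> Y_seq n"
    and free: "\<And>i r. i < n \<Longrightarrow> r < 4 \<Longrightarrow>
      \<not> attacks ((rot ^^ r) (int (X_seq i), int (Y_seq i))) (x, int k)"
  shows "k = Y_seq n \<and> \<bar>x\<bar> = int (X_seq n)"
proof -
  have free': "nat \<bar>x\<bar> \<noteq> X_seq i \<and> nat \<bar>x\<bar> \<noteq> Y_seq i \<and>
      nat (int k - \<bar>x\<bar>) \<noteq> M_seq i \<and> nat (int k - \<bar>x\<bar>) \<noteq> P_seq i" if "i < n" for i
  proof -
    have "\<not> (\<exists>r<4. attacks ((rot ^^ r) (int (X_seq i), int (Y_seq i))) (x, int k))"
      using free that by blast
    then have "\<bar>x\<bar> \<noteq> int (X_seq i)" "\<bar>x\<bar> \<noteq> int (Y_seq i)"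
      "\<bar>x - int k\<bar> \<noteq> int (M_seq i)" "\<bar>x - int k\<bar> \<noteq> int (P_seq i)"
      "\<bar>x + int k\<bar> \<noteq> int (M_seq i)" "\<bar>x + int k\<bar> \<noteq> int (P_seq i)"
      unfolding orbit_attacks_iff by blast+
    moreover have "int k - \<bar>x\<bar> = \<bar>x - int k\<bar> \<or> int k - \<bar>x\<bar> = \<bar>x + int k\<bar>"
      using assms(1) by linarith
    ultimately show ?thesis using assms(1) by (metis abs_ge_zero int_nat_eq diff_ge_0_iff_ge)
  qed
  then have "nat \<bar>x\<bar> \<notin> X_seq ` {..<n} \<union> Y_seq ` {..<n}"
    "nat (int k - \<bar>x\<bar>) \<notin> M_seq ` {..<n} \<union> P_seq ` {..<n}" by blast+
  then have "X_seq n \<le> nat \<bar>x\<bar>" "M_seq n \<le> nat (int k - \<bar>x\<bar>)"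
    using X_le M_le by blast+
  then show ?thesis using assms(1,2) Y_eq[of n] by linarith
qed

lemma dominated:
  assumes "m \<notin> {idx n r | n r. r < 4}"
  shows "\<exists>m'\<in>{idx n r | n r. r < 4}. m' < m \<and> attacks (spiral m') (spiral m)"
proof -
  have "m \<noteq> 0"
  proof
    assume "m = 0"
    then have "m = idx 0 0" by (simp add: idx_def)
    with assms show False by force
  qed
  then obtain k s j where m: "m = (2 * k - 1)\<^sup>2 + 2 * k * s + j" and s: "s < 4" and j: "j < 2 * k"
    by (rule spiral_index_cases)
  define x where "x = int k - 1 - int j"
  have sp: "spiral m = (rot ^^ s) (x, int k)" unfolding m x_def by (rule spiral_rot[OF s j])
  have "strict_mono Y_seq" by (intro strict_monoI Y_less)
  then have ex: "k \<le> Y_seq k" by (rule strict_mono_imp_increasing)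
  define n where "n = (LEAST n. k \<le> Y_seq n)"
  have kn: "k \<le> Y_seq n" unfolding n_def by (rule LeastI[of "\<lambda>n. k \<le> Y_seq n", OF ex])
  have below: "Y_seq i < k" if "i < n" for i
    using not_less_Least[of i "\<lambda>n. k \<le> Y_seq n"] that by (simp add: n_def)
  have "n \<noteq> 0" using kn j by (intro notI) simp
  show ?thesis
  proof (cases "\<exists>i<n. \<exists>r<4. attacks ((rot ^^ r) (int (X_seq i), int (Y_seq i))) (x, int k)")
    case True
    then obtain i r where i: "i < n" and
      att: "attacks ((rot ^^ r) (int (X_seq i), int (Y_seq i))) (x, int k)" by blast
    define r' where "r' = (s + r) mod 4"
    have r': "r' < 4" by (simp add: r'_def)
    have "spiral (idx i r') = (rot ^^ s) ((rot ^^ r) (int (X_seq i), int (Y_seq i)))"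
      by (simp only: spiral_idx[OF r'], simp only: r'_def rot_pow_mod funpow_add comp_apply)
    then have "attacks (spiral (idx i r')) (spiral m)"
      unfolding sp by (simp only: attacks_rot_pow att)
    moreover have "idx i r' < m" using idx_less_shell[OF r' below[OF i]] m by linarith
    ultimately show ?thesis using r' by blast
  next
    case False
    have "\<bar>x\<bar> \<le> int k" using j by (simp add: x_def)
    then have k: "k = Y_seq n" and absx: "\<bar>x\<bar> = int (X_seq n)"
      using free_cell[of x k n] kn False by blast+
    have Mn: "M_seq n \<ge> 1" using M_pos[of n] \<open>n \<noteq> 0\<close> by simp
    \<comment> \<open>The cell is not a claimed queen, so up to rotation it is \<open>(- X\<^sub>n, Y\<^sub>n)\<close>.\<close>
    have "x \<noteq> int (X_seq n)"
    proof
      assume "x = int (X_seq n)"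
      then have "j = M_seq n - 1" using k by (simp add: x_def Y_eq)
      then have "m = idx n s" using \<open>n \<noteq> 0\<close> by (simp add: m idx_def k)
      with assms s show False by blast
    qed
    then have "x < int (X_seq n)" using absx by linarith
    then have "idx n s < m" using \<open>n \<noteq> 0\<close> k Mn by (simp add: idx_def m x_def Y_eq)
    moreover have "attacks (spiral (idx n s)) (spiral m)"
      unfolding spiral_idx[OF s] sp attacks_rot_pow by (simp add: attacks_def k)
    ultimately show ?thesis using s by blast
  qed
qed

lemma independent:
  assumes "idx i r < idx n s" "r < 4" "s < 4"
  shows "\<not> attacks (spiral (idx i r)) (spiral (idx n s))"
proof (cases i n rule: linorder_cases)
  case less
  then show ?thesis using not_attacks_earlier assms by (simp add: spiral_idx)
next
  case equal
  then have "0 < n" "r \<noteq> s" using assms(1) by (auto simp: idx_def split: if_splits)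
  then show ?thesis using not_attacks_orbit assms equal by (simp add: spiral_idx)
next
  case greater
  then show ?thesis using idx_less[OF greater assms(3), of r] assms(1) by simp
qed

lemma has_queen_iff: "has_queen m \<longleftrightarrow> m \<in> {idx n r | n r. r < 4}"
  by (rule has_queen_iffI) (use independent dominated in blast)+

section \<open>Enumerating the queens\<close>

lemma enumerate_range_strict_mono:
  fixes f :: "nat \<Rightarrow> nat"
  assumes "strict_mono f"
  shows "enumerate (range f) n = f n"
proof -
  have inf: "infinite (range f)"
    using assms by (simp add: range_inj_infinite strict_mono_imp_inj_on)
  show ?thesis
  proof (induction n)
    case 0
    show ?case unfolding enumerate_0
      by (rule Least_equality) (auto simp: strict_mono_less_eq[OF assms])
  next
    case (Suc n)
    show ?case unfolding enumerate_Suc''[OF inf] Suc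
      by (rule Least_equality)
        (auto simp: strict_mono_less[OF assms] strict_mono_less_eq[OF assms])
  qed
qed

text \<open>The spiral index of queen number \<open>m\<close>: after \<open>q\<^sub>0\<close> in cell \<open>0\<close> the queens come in groups of
  four, one for each rotation.\<close>

definition queen_index :: "nat \<Rightarrow> nat" where
  "queen_index m = (if m = 0 then 0 else idx ((m - 1) div 4 + 1) ((m - 1) mod 4))"

lemma queen_index_eq: "r < 4 \<Longrightarrow> queen_index (4 * k + r + 1) = idx (k + 1) r"
  by (simp add: queen_index_def)

lemma strict_mono_queen_index: "strict_mono queen_index"
proof (unfold strict_mono_Suc_iff, rule allI)
  fix m
  show "queen_index m < queen_index (Suc m)"
  proof (cases m)
    case 0
    then show ?thesis using idx_less[of 0 1 0 0] by (simp add: queen_index_def idx_def)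
  next
    case (Suc l)
    define k r where "k = l div 4" and "r = l mod 4"
    have l: "l = 4 * k + r" and r: "r < 4" by (simp_all add: k_def r_def)
    show ?thesis
    proof (cases "r = 3")
      case True
      have "queen_index m = idx (k + 1) 3" using queen_index_eq[of 3 k] Suc l True by simp
      moreover have "queen_index (Suc m) = idx (k + 2) 0"
        using queen_index_eq[of 0 "k + 1"] Suc l True by simp
      ultimately show ?thesis using idx_less[of "k + 1" "k + 2" 3 0] by simp
    next
      case False
      have "queen_index m = idx (k + 1) r" using queen_index_eq[OF r, of k] Suc l by simp
      moreover have "queen_index (Suc m) = idx (k + 1) (r + 1)"
        using queen_index_eq[of "r + 1" k] Suc l r False by simp
      moreover have "0 < Y_seq (k + 1)" using X_pos[of "k + 1"] by (simp add: Y_eq)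
      ultimately show ?thesis by (simp add: idx_def)
    qed
  qed
qed

lemma range_queen_index: "range queen_index = {idx n r | n r. r < 4}"
proof (intro equalityI subsetI)
  fix m assume "m \<in> range queen_index"
  then obtain l where m: "m = queen_index l" by blast
  have "m = idx 0 0" if "l = 0" using that by (simp add: m queen_index_def idx_def)
  moreover have "m = idx ((l - 1) div 4 + 1) ((l - 1) mod 4)" if "l \<noteq> 0"
    using that by (simp add: m queen_index_def)
  moreover have "(0::nat) < 4" "(l - 1) mod 4 < 4" by simp_all
  ultimately show "m \<in> {idx n r | n r. r < 4}" by blast
next
  fix m assume "m \<in> {idx n r | n r. r < 4}"
  then obtain n r where m: "m = idx n r" and r: "r < 4" by blast
  show "m \<in> range queen_index"
  proof (cases n)
    case 0
    then have "m = queen_index 0" by (simp add: m idx_def queen_index_def)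
    then show ?thesis by blast
  next
    case (Suc k)
    then have "m = queen_index (4 * k + r + 1)" using queen_index_eq[OF r, of k] m by simp
    then show ?thesis by blast
  qed
qed

lemma queen_eq: "queen m = spiral (queen_index m)"
proof -
  have "{m. has_queen m} = range queen_index"
    unfolding range_queen_index using has_queen_iff by blast
  then show ?thesis
    unfolding queen_def by (simp add: enumerate_range_strict_mono strict_mono_queen_index)
qed

lemma queen_orbit:
  assumes "m = 4 * k + r + 1" "r < 4"
  shows "queen m = (rot ^^ r) (int (X_seq (k + 1)), int (Y_seq (k + 1)))"
  unfolding queen_eq assms(1) queen_index_eq[OF assms(2)] by (rule spiral_idx[OF assms(2)])

theorem theorem1:
  shows "queen 0 = (int (X_seq 0), int (Y_seq 0)) \<and> (int (X_seq 0), int (Y_seq 0)) = (0, 0) \<and>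
    (\<forall>k::nat.
      queen (4 * k + 1) = (int (X_seq (k + 1)), int (Y_seq (k + 1))) \<and>
      queen (4 * k + 2) = (- int (Y_seq (k + 1)), int (X_seq (k + 1))) \<and>
      queen (4 * k + 3) = (- int (X_seq (k + 1)), - int (Y_seq (k + 1))) \<and>
      queen (4 * k + 4) = (int (Y_seq (k + 1)), - int (X_seq (k + 1))))"
proof (intro conjI allI)
  show "queen 0 = (int (X_seq 0), int (Y_seq 0))"
    by (simp add: queen_eq queen_index_def spiral_def)
  show "(int (X_seq 0), int (Y_seq 0)) = (0, 0)" by simp
  fix k :: nat
  show "queen (4 * k + 1) = (int (X_seq (k + 1)), int (Y_seq (k + 1)))"
    using queen_orbit[of "4 * k + 1" k 0] by simp
  show "queen (4 * k + 2) = (- int (Y_seq (k + 1)), int (X_seq (k + 1)))"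
    using queen_orbit[of "4 * k + 2" k 1] by (simp add: rot_def)
  show "queen (4 * k + 3) = (- int (X_seq (k + 1)), - int (Y_seq (k + 1)))"
    using queen_orbit[of "4 * k + 3" k 2] by simp
  show "queen (4 * k + 4) = (int (Y_seq (k + 1)), - int (X_seq (k + 1)))"
    using queen_orbit[of "4 * k + 4" k 3] by simp
qed

end
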